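(* Let $B$ be a unital algebra over a field $K$, let $(A,E)$ be any $B$-valued noncommutative probability space, and let $x,y\in A$ be free random variables. Then the unsymmetrized R-transforms of the distribution series satisfy $$\widetilde R_{\widetilde\Phi_{x+y}}=\widetilde R_{\widetilde\Phi_x}+\widetilde R_{\widetilde\Phi_y}.$$
   Context: Noncommutative probability. For a unital algebra $B$ over a field $K$, a $B$-valued noncommutative probability space is a pair $(A,E)$ where $A$ is a unital algebra containing $B$ as a unital subalgebra and $E:A\to B$ is a linear idempotent map restricting to the identity on $B$ and satisfying $E(b_1ab_2)=b_1E(a)b_2$ for $b_1,b_2\in B$, $a\in A$. Elements of $A$ are called random variables. Subalgebras $A_i\subseteq A$ ($i\in I$), each containing $B$, are free if $E(a_1a_2\cdots a_n)=0$ whenever $n\in\mathbf N$, $a_j\in A_{i_j}\cap\ker E$ and $i_1\ne i_2,\ldots,i_{n-1}\ne i_n$. Random variables $a_i$ are free if the algebras generated by $\{a_i\}\cup B$ are free. Formal multilinear function series. $\mathrm{Mul}[[B]]$ is the set of sequences $\alpha=(\alpha_0,\alpha_1,\alpha_2,\ldots)$ with $\alpha_0\in B$ and, for $n\ge1$, $\alpha_n:B\times\cdots\times B\to B$ an $n$-multilinear ($K$-multilinear) map. Addition is termwise. The formal product is $(\alpha\beta)_n(b_1,\ldots,b_n)=\sum_{k=0}^n\alpha_k(b_1,\ldots,b_k)\beta_{n-k}(b_{k+1},\ldots,b_n)$ (with $(\alpha\beta)_0=\alpha_0\beta_0$). If $\beta_0=0$, the formal composition $\alpha\circ\beta$ is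 given by $(\alpha\circ\beta)_0=\alpha_0$ and, for $n\ge1$, $$(\alpha\circ\beta)_n(b_1,\ldots,b_n)=\sum_{k=1}^n\ \sum_{\substack{p_1,\ldots,p_k\ge1 \\ p_1+\cdots+p_k=n}}\alpha_k\big(\beta_{p_1}(b_{q_1+1},\ldots,b_{q_1+p_1}),\ldots,\beta_{p_k}(b_{q_k+1},\ldots,b_{q_k+p_k})\big),$$ where $q_j=p_1+\cdots+p_{j-1}$ (so $q_1=0$). Put $1=(1,0,0,\ldots)$ (identity for the formal product) and $I=(0,\mathrm{id}_B,0,0,\ldots)$ (identity for formal composition). $\alpha^{-1}$ denotes the inverse with respect to the formal product (it exists iff $\alpha_0$ is invertible) and $\alpha^{\langle-1\rangle}$ the inverse with respect to formal composition (for $\alpha_0=0$ it exists iff $\alpha_1$ is an invertible linear map $B\to B$). The distribution series of $a\in A$ is $\widetilde\Phi_a\in\mathrm{Mul}[[B]]$ with $\widetilde\Phi_{a,0}=E(a)$ and $\widetilde\Phi_{a,n}(b_1,\ldots,b_n)=E(ab_1ab_2\cdots ab_na)$ for $n\ge1$. The unsymmetrized R-transform of $\beta\in\mathrm{Mul}[[B]]$ is $\widetilde R_\beta=\big((1+\beta I)^{-1}\beta\big)\circ(I+I\beta I)^{\langle-1\rangle}\in\mathrm{Mul}[[B]]$ (products are formal products). *)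

theory Defs
  imports Complex_Main
begin

(* The sort {ring, monoid_mult} is that of unital rings in which 0 = 1 is not excluded. *)

locale unital_algebra = vector_space scale
  for scale :: "'k::field \<Rightarrow> 'b::{ring, monoid_mult} \<Rightarrow> 'b" +
  assumes scale_mult_left: "scale c (x * y) = scale c x * y"
    and scale_mult_right: "scale c (x * y) = x * scale c y"

(* The inclusion of B in A is an injective unital algebra homomorphism emb, and the expectation
   takes its values in the type of B.  Idempotency of emb o E is then E_emb. *)

locale valued_ncps =
  B: unital_algebra scaleB + A: unital_algebra scaleA
  for scaleB :: "'k::field \<Rightarrow> 'b::{ring, monoid_mult} \<Rightarrow> 'b"
    and scaleA :: "'k \<Rightarrow> 'a::{ring, monoid_mult} \<Rightarrow> 'a"
    and emb :: "'b \<Rightarrow> 'a"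
    and E :: "'a \<Rightarrow> 'b" +
  assumes emb_linear: "Vector_Spaces.linear scaleB scaleA emb"
    and emb_mult: "emb (b1 * b2) = emb b1 * emb b2"
    and emb_one: "emb 1 = 1"
    and emb_inj: "inj emb"
    and E_linear: "Vector_Spaces.linear scaleA scaleB E"
    and E_emb: "E (emb b) = b"
    and E_bimodule: "E (emb b1 * a * emb b2) = b1 * E a * b2"

definition is_subalgebra ::
    "('k::field \<Rightarrow> 'a::{ring, monoid_mult} \<Rightarrow> 'a) \<Rightarrow> 'a set \<Rightarrow> bool" where
  "is_subalgebra scale S \<longleftrightarrow>
     module.subspace scale S \<and> 1 \<in> S \<and> (\<forall>x\<in>S. \<forall>y\<in>S. x * y \<in> S)"

definition free_subalgebras ::
    "('k::field \<Rightarrow> 'a::{ring, monoid_mult} \<Rightarrow> 'a) \<Rightarrow> ('b::{ring, monoid_mult} \<Rightarrow> 'a) \<Rightarrow> ('a \<Rightarrow> 'b)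
      \<Rightarrow> 'i set \<Rightarrow> ('i \<Rightarrow> 'a set) \<Rightarrow> bool" where
  "free_subalgebras scaleA emb E J S \<longleftrightarrow>
     (\<forall>i\<in>J. is_subalgebra scaleA (S i) \<and> range emb \<subseteq> S i) \<and>
     (\<forall>is as. as \<noteq> [] \<and> length is = length as \<and> set is \<subseteq> J \<and> distinct_adj is \<and>
        (\<forall>j<length as. as ! j \<in> S (is ! j) \<and> E (as ! j) = 0) \<longrightarrow>
        E (prod_list as) = 0)"

definition free_variables ::
    "('k::field \<Rightarrow> 'a::{ring, monoid_mult} \<Rightarrow> 'a) \<Rightarrow> ('b::{ring, monoid_mult} \<Rightarrow> 'a) \<Rightarrow> ('a \<Rightarrow> 'b)
      \<Rightarrow> 'i set \<Rightarrow> ('i \<Rightarrow> 'a) \<Rightarrow> bool" where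
  "free_variables scaleA emb E J a \<longleftrightarrow>
     free_subalgebras scaleA emb E J (\<lambda>i. is_subalgebra scaleA hull ({a i} \<union> range emb))"

(* A sequence of maps alpha_n from B^n to B is encoded as one function on lists: alpha_n is its
   restriction to lists of length n, and alpha_0 is its value at the empty list. *)

type_synonym 'b series = "'b list \<Rightarrow> 'b"

definition Mul :: "('k::field \<Rightarrow> 'b::ab_group_add \<Rightarrow> 'b) \<Rightarrow> 'b series set" where
  "Mul scale = {\<alpha>. \<forall>bs. \<forall>i<length bs. Vector_Spaces.linear scale scale (\<lambda>b. \<alpha> (bs[i := b]))}"

definition mul_add :: "'b::ab_group_add series \<Rightarrow> 'b series \<Rightarrow> 'b series" (infixl "\<oplus>" 65) where
  "\<alpha> \<oplus> \<beta> = (\<lambda>bs. \<alpha> bs + \<beta> bs)"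

definition mul_prod :: "'b::ring series \<Rightarrow> 'b series \<Rightarrow> 'b series" (infixl "\<odot>" 70) where
  "\<alpha> \<odot> \<beta> = (\<lambda>bs. \<Sum>k=0..length bs. \<alpha> (take k bs) * \<beta> (drop k bs))"

(* Only meaningful when beta has zero constant term. With indices shifted to start at 0, the
   number q_j is the sum of the first j parts of ps. *)

definition mul_comp :: "'b::ab_group_add series \<Rightarrow> 'b series \<Rightarrow> 'b series" (infixl "\<circledcirc>" 75) where
  "\<alpha> \<circledcirc> \<beta> = (\<lambda>bs. if bs = [] then \<alpha> [] else
     (\<Sum>k=1..length bs.
        \<Sum>ps | length ps = k \<and> (\<forall>p\<in>set ps. p \<ge> 1) \<and> sum_list ps = length bs.
          \<alpha> (map (\<lambda>j. \<beta> (take (ps ! j) (drop (sum_list (take j ps)) bs))) [0..<k])))"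

definition mul_one :: "'b::{ring, monoid_mult} series" where
  "mul_one = (\<lambda>bs. case bs of [] \<Rightarrow> 1 | _ \<Rightarrow> 0)"

definition mul_id :: "'b::ab_group_add series" where
  "mul_id = (\<lambda>bs. case bs of [b] \<Rightarrow> b | _ \<Rightarrow> 0)"

definition mul_inverse ::
    "('k::field \<Rightarrow> 'b::{ring, monoid_mult} \<Rightarrow> 'b) \<Rightarrow> 'b series \<Rightarrow> 'b series" where
  "mul_inverse scale \<alpha> = (THE \<gamma>. \<gamma> \<in> Mul scale \<and> \<gamma> \<odot> \<alpha> = mul_one \<and> \<alpha> \<odot> \<gamma> = mul_one)"

definition mul_comp_inverse ::
    "('k::field \<Rightarrow> 'b::ab_group_add \<Rightarrow> 'b) \<Rightarrow> 'b series \<Rightarrow> 'b series" where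
  "mul_comp_inverse scale \<alpha> =
     (THE \<gamma>. \<gamma> \<in> Mul scale \<and> \<gamma> [] = 0 \<and> \<gamma> \<circledcirc> \<alpha> = mul_id \<and> \<alpha> \<circledcirc> \<gamma> = mul_id)"

definition distribution_series ::
    "('b::{ring, monoid_mult} \<Rightarrow> 'a::{ring, monoid_mult}) \<Rightarrow> ('a \<Rightarrow> 'b) \<Rightarrow> 'a \<Rightarrow> 'b series" where
  "distribution_series emb E a = (\<lambda>bs. E (prod_list (map (\<lambda>b. a * emb b) bs) * a))"

definition R_transform ::
    "('k::field \<Rightarrow> 'b::{ring, monoid_mult} \<Rightarrow> 'b) \<Rightarrow> 'b series \<Rightarrow> 'b series" where
  "R_transform scale \<beta> =
     (mul_inverse scale (mul_one \<oplus> \<beta> \<odot> mul_id) \<odot> \<beta>)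
       \<circledcirc> mul_comp_inverse scale (mul_id \<oplus> mul_id \<odot> \<beta> \<odot> mul_id)"

end

theory Submission
  imports Defs
begin

text \<open>
  The proof is Haagerup's argument for the additivity of the R-transform, carried out with formal
  series whose coefficients lie in the algebra \<open>A\<close>.

  Write \<open>g\<close> for the identity series \<open>I\<close>, thought of as a generic element of \<open>B\<close>, and \<open>\<Phi>\<close> for the
  distribution series of \<open>x\<close>. The compositional inverse \<open>f\<close> of \<open>I + I\<Phi>I\<close> and the R-transform \<open>r\<close> of
  \<open>\<Phi>\<close> are linked by \<open>(1 + gr)f = g\<close> and \<open>(1 + I\<Phi>) \<circ> f = 1 + gr\<close>, and these two equations determine
  \<open>r\<close> (\<open>R_transform_equation\<close>, \<open>R_transform_unique\<close>). Over \<open>A\<close> the series \<open>1 + I\<Phi>\<close> is the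
  expectation of the resolvent \<open>(1 - gx)\<^sup>-\<^sup>1\<close>; substituting \<open>f\<close> for \<open>g\<close> and using
  \<open>1 - g(x - r) = (1 + gr)(1 - fx)\<close>, the second equation becomes
  \<open>E ((1 - g(x - r))\<^sup>-\<^sup>1) = 1\<close> (\<open>ex_geo_eq_one_iff\<close>). Thus \<open>r\<close> is the R-transform of \<open>x\<close> exactly
  when this shifted resolvent is the unit plus a centered series.

  Let now \<open>u = g(x - r\<^sub>x)\<close> and \<open>v = g(y - r\<^sub>y)\<close>, and write \<open>(1 - u)\<^sup>-\<^sup>1 = 1 + a\<close> and
  \<open>(1 - v)\<^sup>-\<^sup>1 = 1 + b\<close>, where \<open>a\<close> and \<open>b\<close> are centered series over the algebras generated by \<open>x\<close>
  and by \<open>y\<close>. Then \<open>1 - (u + v) = (1 - u)(1 - ab)(1 - v)\<close>, so that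
  \<open>(1 - u - v)\<^sup>-\<^sup>1 = \<Sum>\<^sub>n (1 + b)(ab)\<^sup>n(1 + a)\<close>. Apart from the unit, every term is an alternating
  product of centered series, hence has expectation zero by freeness (\<open>ex_geo_add_free\<close>). As
  \<open>u + v = g((x + y) - (r\<^sub>x + r\<^sub>y))\<close>, the characterization says that \<open>r\<^sub>x + r\<^sub>y\<close> is the
  R-transform of \<open>x + y\<close>.

  All inverses are geometric series in series without constant term, hence finite sums at each word.
  The remaining work is the calculus of series: the ring laws, associativity of substitution and
  compatibility of substitution with products.
\<close>

section \<open>The ring of word series\<close>

text \<open>
  Separating the arguments of a series (type \<open>'b\<close>) from its values (type \<open>'v\<close>) allows series in elements
  of \<open>B\<close> with coefficients in \<open>A\<close>. As a type of its own, series form a ring under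
  convolution, and the manipulations with inverses become ring calculations.
\<close>

typedef ('b, 'v) ser = "UNIV :: ('b list \<Rightarrow> 'v) set"
  morphisms coeff Ser by simp

lemma coeff_Ser [simp]: "coeff (Ser f) = f"
  by (simp add: Ser_inverse)

lemma ser_eqI: "(\<And>bs. coeff a bs = coeff b bs) \<Longrightarrow> a = b"
  by (metis coeff_inverse ext)

definition splits :: "'b list \<Rightarrow> ('b list \<times> 'b list) set" where
  "splits bs = {(us, vs). us @ vs = bs}"

lemma splits_Nil [simp]: "splits [] = {([], [])}"
  by (auto simp: splits_def)

lemma splits_Cons: "splits (b # bs) = insert ([], b # bs) ((\<lambda>(us, vs). (b # us, vs)) ` splits bs)"
  by (auto simp: splits_def Cons_eq_append_conv append_eq_Cons_conv image_iff)

lemma finite_splits [simp]: "finite (splits bs)"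
  by (induction bs) (simp_all add: splits_Cons)

lemma splits_length: "(us, vs) \<in> splits bs \<Longrightarrow> length us \<le> length bs \<and> length vs \<le> length bs"
  by (auto simp: splits_def)

lemma sum_splits_Cons:
  "(\<Sum>(us, vs)\<in>splits (b # bs). f us vs) = f [] (b # bs) + (\<Sum>(us, vs)\<in>splits bs. f (b # us) vs)"
  (is "_ = _ + ?S")
proof -
  let ?g = "\<lambda>(us, vs). (b # us, vs)"
  have "([], b # bs) \<notin> ?g ` splits bs" by auto
  then have "(\<Sum>(us, vs)\<in>splits (b # bs). f us vs) = f [] (b # bs) + (\<Sum>(us, vs)\<in>?g ` splits bs. f us vs)"
    by (simp add: splits_Cons)
  also have "(\<Sum>(us, vs)\<in>?g ` splits bs. f us vs) = ?S"
    by (subst sum.reindex) (auto simp: inj_on_def case_prod_unfold)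
  finally show ?thesis .
qed

lemma sum_case_prod_add:
  "(\<Sum>(u, v)\<in>S. f u v + g u v) = (\<Sum>(u, v)\<in>S. f u v) + (\<Sum>(u, v)\<in>S. g u v)"
  by (simp add: case_prod_unfold sum.distrib)

text \<open>
  Cutting a word into three pieces can begin with either cut; associativity of all products below
  comes from this.
\<close>

lemma sum_splits_assoc:
  fixes g :: "'b list \<Rightarrow> 'b list \<Rightarrow> 'b list \<Rightarrow> 'v::comm_monoid_add"
  shows "(\<Sum>(us, t)\<in>splits bs. \<Sum>(vs, ws)\<in>splits t. g us vs ws) =
    (\<Sum>(t, ws)\<in>splits bs. \<Sum>(us, vs)\<in>splits t. g us vs ws)"
proof (induction bs arbitrary: g)
  case Nil
  then show ?case by simp
next
  case (Cons b bs)
  then show ?case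
    by (simp add: sum_splits_Cons sum_case_prod_add add.assoc)
qed

text \<open>
  The marked letter \<open>b\<close> lies in the right part or in the left part of the cut. This isolates the factor
  that depends on \<open>b\<close> when linearity in that letter is checked.
\<close>

lemma sum_splits_middle:
  fixes f :: "'b list \<Rightarrow> 'b list \<Rightarrow> 'v::comm_monoid_add"
  shows "(\<Sum>(p, q)\<in>splits (us @ b # vs). f p q) =
    (\<Sum>(p, q)\<in>splits us. f p (q @ b # vs)) + (\<Sum>(p, q)\<in>splits vs. f (us @ b # p) q)"
proof (induction us arbitrary: f)
  case Nil
  then show ?case by (simp add: sum_splits_Cons)
next
  case (Cons u us)
  then show ?case by (simp add: sum_splits_Cons add.assoc)
qed

instantiation ser :: (type, zero) zero
begin
definition zero_ser_def: "0 = Ser (\<lambda>_. 0)"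
instance ..
end

instantiation ser :: (type, plus) plus
begin
definition plus_ser_def: "a + b = Ser (\<lambda>bs. coeff a bs + coeff b bs)"
instance ..
end

instantiation ser :: (type, minus) minus
begin
definition minus_ser_def: "a - b = Ser (\<lambda>bs. coeff a bs - coeff b bs)"
instance ..
end

instantiation ser :: (type, uminus) uminus
begin
definition uminus_ser_def: "- a = Ser (\<lambda>bs. - coeff a bs)"
instance ..
end

instantiation ser :: (type, "{zero, one}") one
begin
definition one_ser_def: "1 = Ser (\<lambda>bs. if bs = [] then 1 else 0)"
instance ..
end

lemma coeff_0 [simp]: "coeff 0 bs = 0"
  and coeff_add [simp]: "coeff (a + b) bs = coeff a bs + coeff b bs"
  and coeff_diff [simp]: "coeff (a' - b') bs = coeff a' bs - coeff b' bs"
  and coeff_uminus [simp]: "coeff (- a'') bs = - coeff a'' bs"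
  and coeff_1: "coeff 1 bs = (if bs = [] then 1 else 0)"
  by (simp_all add: zero_ser_def plus_ser_def minus_ser_def uminus_ser_def one_ser_def)

instance ser :: (type, ab_group_add) ab_group_add
  by standard (rule ser_eqI, simp add: algebra_simps)+

definition const :: "'v::zero \<Rightarrow> ('b, 'v) ser" where
  "const v = Ser (\<lambda>bs. if bs = [] then v else 0)"

definition shift :: "('b, 'v) ser \<Rightarrow> 'b \<Rightarrow> ('b, 'v) ser" where
  "shift a b = Ser (\<lambda>bs. coeff a (b # bs))"

text \<open>
  The common generalization of product and substitution: the first segment of the word is fed to
  \<open>d\<close>, and its value selects the series that reads the rest. With \<open>c \<mapsto> smult c b\<close> as \<open>f\<close> it is the
  product \<open>d * b\<close>; with \<open>c \<mapsto> subst (shift a c) b\<close> it describes a composition after its first letter.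
  Proving the laws for \<open>bind\<close> once serves both.
\<close>

definition bind :: "('b, 'c) ser \<Rightarrow> ('c \<Rightarrow> ('b, 'v::ab_group_add) ser) \<Rightarrow> ('b, 'v) ser" where
  "bind d f = Ser (\<lambda>bs. \<Sum>(us, vs)\<in>splits bs. coeff (f (coeff d us)) vs)"

definition smult :: "'v::ring \<Rightarrow> ('b, 'v) ser \<Rightarrow> ('b, 'v) ser" where
  "smult c a = Ser (\<lambda>bs. c * coeff a bs)"

definition map_ser :: "('v \<Rightarrow> 'w) \<Rightarrow> ('b, 'v) ser \<Rightarrow> ('b, 'w) ser" where
  "map_ser h a = Ser (\<lambda>bs. h (coeff a bs))"

lemma coeff_const: "coeff (const v) bs = (if bs = [] then v else 0)"
  and coeff_shift [simp]: "coeff (shift a b) bs = coeff a (b # bs)"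
  and coeff_bind: "coeff (bind d f) bs = (\<Sum>(us, vs)\<in>splits bs. coeff (f (coeff d us)) vs)"
  and coeff_smult [simp]: "coeff (smult c s) bs = c * coeff s bs"
  and coeff_map_ser [simp]: "coeff (map_ser h a') bs = h (coeff a' bs)"
  by (simp_all add: const_def shift_def bind_def smult_def map_ser_def)

lemma coeff_bind_Nil [simp]: "coeff (bind d f) [] = coeff (f (coeff d [])) []"
  by (simp add: coeff_bind)

lemma ser_eq_shiftI: "coeff a [] = coeff b [] \<Longrightarrow> (\<And>c. shift a c = shift b c) \<Longrightarrow> a = b"
  by (metis coeff_shift neq_Nil_conv ser_eqI)

lemma additive_0: "f 0 = 0" if "\<And>x y. f (x + y) = f x + f y"
  for f :: "'a::ab_group_add \<Rightarrow> 'b::ab_group_add"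
  by (metis add_cancel_right_left add_0 that)

lemma additive_sum: "f (sum g S) = (\<Sum>x\<in>S. f (g x))" if "\<And>x y. f (x + y) = f x + f y"
  for f :: "'a::ab_group_add \<Rightarrow> 'b::ab_group_add"
  by (induction S rule: infinite_finite_induct) (simp_all add: that additive_0[of f])

lemma coeff_sum: "coeff (sum f S) bs = (\<Sum>x\<in>S. coeff (f x) bs)"
  by (rule additive_sum) simp

lemma bind_shift: "shift (bind d f) c = bind (shift d c) f + shift (f (coeff d [])) c"
  by (rule ser_eqI) (simp add: coeff_bind sum_splits_Cons)

lemma bind_const: "bind (const v) f = f v" if "f 0 = 0"
proof (rule ser_eqI)
  fix bs
  show "coeff (bind (const v) f) bs = coeff (f v) bs"
    by (cases bs) (simp_all add: coeff_bind sum_splits_Cons coeff_const that)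
qed

lemma shift_const [simp]: "shift (const v) c = 0"
  by (rule ser_eqI) (simp add: coeff_const)

lemma bind_const_right: "bind d const = d"
proof (rule ser_eqI)
  fix bs
  show "coeff (bind d const) bs = coeff d bs"
  proof (induction bs arbitrary: d)
    case (Cons b bs)
    have "coeff (bind d const) (b # bs) = coeff (shift (bind d const) b) bs"
      by simp
    then show ?case
      by (simp only: bind_shift Cons shift_const coeff_add) simp
  qed (simp add: coeff_const)
qed

text \<open>
  On the left \<open>f\<close> is applied to a sum over the ways to cut the first segment; additivity of
  \<open>f\<close> turns this into a sum over two cuts.
\<close>

lemma bind_assoc:
  fixes p :: "('b, 'c) ser" and q :: "'c \<Rightarrow> ('b, 'd::ab_group_add) ser"
  assumes "\<And>x y. f (x + y) = f x + f y"
  shows "bind (bind p q) f = bind p (\<lambda>c. bind (q c) f)"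
proof (rule ser_eqI)
  fix bs
  have add: "coeff (f (\<Sum>x\<in>S. g x)) vs = (\<Sum>x\<in>S. coeff (f (g x)) vs)"
    for S :: "('b list \<times> 'b list) set" and g vs
    by (rule additive_sum) (simp add: assms)
  show "coeff (bind (bind p q) f) bs = coeff (bind p (\<lambda>c. bind (q c) f)) bs"
    using sum_splits_assoc[of "\<lambda>us vs ws. coeff (f (coeff (q (coeff p us)) vs)) ws" bs]
    by (simp add: coeff_bind case_prod_unfold add)
qed

lemma bind_cong_length:
  assumes "\<And>c vs. length vs \<le> length bs \<Longrightarrow> coeff (f c) vs = coeff (g c) vs"
  shows "coeff (bind d f) bs = coeff (bind d g) bs"
  unfolding coeff_bind
  by (rule sum.cong) (auto simp: assms dest: splits_length)

lemma bind_add: "bind d (\<lambda>c. f c + g c) = bind d f + bind d g"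
  by (rule ser_eqI) (simp add: coeff_bind case_prod_unfold sum.distrib)

instantiation ser :: (type, ring) times
begin
definition times_ser_def: "a * b = bind a (\<lambda>c. smult c b)"
instance ..
end

lemma coeff_mult: "coeff (a * b) bs = (\<Sum>(us, vs)\<in>splits bs. coeff a us * coeff b vs)"
  by (simp add: times_ser_def coeff_bind)

lemma coeff_mult_Nil [simp]: "coeff (a * b) [] = coeff a [] * coeff b []"
  by (simp add: coeff_mult)

lemma smult_add_left: "smult (c + d) a = smult c a + smult d a"
  by (rule ser_eqI) (simp add: distrib_right)

lemma smult_mult: "smult c (a * b) = smult c a * b"
  by (rule ser_eqI) (simp add: coeff_mult sum_distrib_left mult.assoc case_prod_unfold)

instance ser :: (type, ring) ring
proof
  fix a b c :: "('a, 'b) ser"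
  show "a * b * c = a * (b * c)"
    using bind_assoc[of "\<lambda>d. smult d c" a "\<lambda>d. smult d b"]
    by (simp add: smult_add_left smult_mult times_ser_def[of a] times_ser_def[of _ c, symmetric])
  show "(a + b) * c = a * c + b * c" "a * (b + c) = a * b + a * c"
    by (rule ser_eqI; simp add: coeff_mult case_prod_unfold sum.distrib algebra_simps)+
qed

lemma one_eq_const: "1 = const 1"
  by (simp add: one_ser_def const_def)

lemma const_mult: "const v * a = smult v a"
  by (simp add: times_ser_def bind_const ser_eqI)

instance ser :: (type, "{ring, monoid_mult}") monoid_mult
proof
  fix a :: "('a, 'b) ser"
  have "bind a (\<lambda>c. smult c (const 1)) = bind a const"
    by (rule arg_cong[of _ _ "bind a"]) (auto intro!: ser_eqI simp: coeff_const)
  then show "a * 1 = a"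
    by (simp add: times_ser_def one_eq_const bind_const_right)
  show "1 * a = a"
    by (simp add: one_eq_const const_mult ser_eqI)
qed

section \<open>Substitution\<close>

text \<open>
  The blocks of a composition of \<open>length bs\<close> into positive parts, kept as subwords so that no
  index arithmetic is needed.
\<close>

definition parts :: "'b list \<Rightarrow> 'b list list set" where
  "parts bs = {css. concat css = bs \<and> [] \<notin> set css}"

lemma parts_Nil [simp]: "parts [] = {[]}"
  by (auto simp: parts_def) (metis list.set_intros(1) neq_Nil_conv)

lemma parts_Cons: "parts (b # bs) = (\<Union>(us, vs)\<in>splits bs. (\<lambda>css. (b # us) # css) ` parts vs)"
proof (intro set_eqI iffI)
  fix css assume css: "css \<in> parts (b # bs)"
  then obtain cs css' where "css = cs # css'" by (cases css) (auto simp: parts_def)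
  moreover from this css obtain us where "cs = b # us" by (cases cs) (auto simp: parts_def)
  ultimately show "css \<in> (\<Union>(us, vs)\<in>splits bs. (\<lambda>css. (b # us) # css) ` parts vs)"
    using css by (auto simp: parts_def splits_def)
qed (auto simp: parts_def splits_def)

lemma finite_parts [simp]: "finite (parts bs)"
proof (induction bs rule: length_induct)
  case (1 bs)
  then show ?case
    by (cases bs) (auto simp: parts_Cons dest: splits_length)
qed

lemma sum_parts_Cons:
  "(\<Sum>css\<in>parts (b # bs). f css) = (\<Sum>(us, vs)\<in>splits bs. \<Sum>css\<in>parts vs. f ((b # us) # css))"
  unfolding parts_Cons
proof (subst sum.UNION_disjoint)
  show "\<forall>i\<in>splits bs. \<forall>j\<in>splits bs. i \<noteq> j \<longrightarrow>
      (case i of (us, vs) \<Rightarrow> (\<lambda>css. (b # us) # css) ` parts vs) \<inter>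
      (case j of (us, vs) \<Rightarrow> (\<lambda>css. (b # us) # css) ` parts vs) = {}"
    by (auto simp: splits_def)
qed (auto simp: case_prod_unfold sum.reindex inj_on_def)

definition subst :: "('c, 'v::ab_group_add) ser \<Rightarrow> ('b, 'c) ser \<Rightarrow> ('b, 'v) ser" where
  "subst a b = Ser (\<lambda>bs. \<Sum>css\<in>parts bs. coeff a (map (coeff b) css))"

lemma coeff_subst: "coeff (subst a b) bs = (\<Sum>css\<in>parts bs. coeff a (map (coeff b) css))"
  by (simp add: subst_def)

lemma coeff_subst_Nil [simp]: "coeff (subst a b) [] = coeff a []"
  by (simp add: coeff_subst)

text \<open>
  The first letter belongs to the first block. All further facts on substitution are obtained
  from this recursion by induction on the length of the word.
\<close>

lemma shift_subst: "shift (subst a b) c = bind (shift b c) (\<lambda>d. subst (shift a d) b)"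
  by (rule ser_eqI) (simp add: coeff_subst coeff_bind sum_parts_Cons)

lemma subst_add: "subst (a + b) c = subst a c + subst b c"
  by (rule ser_eqI) (simp add: coeff_subst sum.distrib)

lemma subst_diff: "subst (a - b) c = subst a c - subst b c"
  by (rule ser_eqI) (simp add: coeff_subst sum_subtractf)

lemma subst_const: "subst (const v) b = const v"
  by (rule ser_eq_shiftI) (auto intro!: ser_eqI simp: shift_subst coeff_bind coeff_subst coeff_const)

lemma subst_one: "subst 1 b = 1"
  by (simp add: one_eq_const subst_const)

lemma map_ser_subst: "map_ser h (subst a b) = subst (map_ser h a) b"
  if "\<And>x y. h (x + y) = h x + h y"
  by (rule ser_eqI) (simp add: coeff_subst additive_sum[of h, OF that])

text \<open>
  Once its first letter is read, the word series \<open>bind d f\<close> splits in two: the letter is read either by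
  \<open>d\<close> or, if \<open>d\<close> receives the empty word, by \<open>f\<close>. Both sides obey the same recursion then.
\<close>

lemma subst_bind:
  fixes f :: "'x::ab_group_add \<Rightarrow> ('c, 'v::ab_group_add) ser"
  assumes f: "\<And>x y. f (x + y) = f x + f y"
  shows "subst (bind d f) g = bind (subst d g) (\<lambda>c. subst (f c) g)"
proof (rule ser_eqI)
  fix bs
  show "coeff (subst (bind d f) g) bs = coeff (bind (subst d g) (\<lambda>c. subst (f c) g)) bs"
  proof (induction bs arbitrary: d rule: length_induct)
    case (1 bs)
    show ?case
    proof (cases bs)
      case Nil
      then show ?thesis by simp
    next
      case (Cons b bs')
      let ?f = "\<lambda>c. subst (f c) g"
      \<comment> \<open>The induction hypothesis applies under the outer \<open>bind\<close> because that only
          reads words no longer than \<open>bs'\<close>.\<close>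
      have "coeff (subst (bind d f) g) bs =
          coeff (bind (shift g b) (\<lambda>c. subst (bind (shift d c) f) g + subst (shift (f (coeff d [])) c) g)) bs'"
        by (simp add: Cons shift_subst bind_shift subst_add flip: coeff_shift)
      also have "\<dots> = coeff (bind (shift g b) (\<lambda>c. bind (subst (shift d c) g) ?f + subst (shift (f (coeff d [])) c) g)) bs'"
        using 1 by (intro bind_cong_length) (simp add: Cons)
      also have "\<dots> = coeff (bind (subst d g) ?f) bs"
        by (simp add: Cons bind_add bind_shift shift_subst bind_assoc f subst_add flip: coeff_shift)
      finally show ?thesis .
    qed
  qed
qed

lemma smult_subst: "subst (smult c a) b = smult c (subst a b)"
  by (rule ser_eqI) (simp add: coeff_subst sum_distrib_left)

lemma subst_mult: "subst (a * b) c = subst a c * subst b c"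
  by (simp add: times_ser_def subst_bind smult_add_left smult_subst)

definition additive_ser :: "('b::ab_group_add, 'v::ab_group_add) ser \<Rightarrow> bool" where
  "additive_ser a \<longleftrightarrow> (\<forall>us b c vs. coeff a (us @ (b + c) # vs) = coeff a (us @ b # vs) + coeff a (us @ c # vs))"

lemma additive_ser_shift: "additive_ser a \<Longrightarrow> additive_ser (shift a c)"
  unfolding additive_ser_def coeff_shift by (metis append_Cons)

lemma additive_ser_shift_add: "additive_ser a \<Longrightarrow> shift a (b + c) = shift a b + shift a c"
  unfolding additive_ser_def by (intro ser_eqI) (metis append_Nil coeff_add coeff_shift)

text \<open>
  Additivity of the outer series is essential: on the right its arguments are the values of
  \<open>subst b c\<close>, which are sums, and only additivity expands them into the terms of the left-hand side.
\<close>

lemma subst_assoc: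
  assumes "additive_ser a"
  shows "subst (subst a b) c = subst a (subst b c)"
proof (rule ser_eqI)
  fix bs
  show "coeff (subst (subst a b) c) bs = coeff (subst a (subst b c)) bs"
    using assms
  proof (induction bs arbitrary: a rule: length_induct)
    case (1 bs)
    show ?case
    proof (cases bs)
      case Nil
      then show ?thesis by simp
    next
      case (Cons x bs')
      have add: "subst (shift a (d + e)) g = subst (shift a d) g + subst (shift a e) g" for d e g
        using 1 by (simp add: additive_ser_shift_add subst_add)
      have "coeff (subst (subst a b) c) bs =
         coeff (bind (shift c x) (\<lambda>d. bind (subst (shift b d) c) (\<lambda>e. subst (subst (shift a e) b) c))) bs'"
        by (simp add: Cons shift_subst subst_bind add flip: coeff_shift)
      also have "\<dots> = coeff (bind (bind (shift c x) (\<lambda>d. subst (shift b d) c)) (\<lambda>e. subst (subst (shift a e) b) c)) bs'"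
        by (simp add: bind_assoc add subst_add)
      also have "\<dots> = coeff (bind (bind (shift c x) (\<lambda>d. subst (shift b d) c)) (\<lambda>e. subst (shift a e) (subst b c))) bs'"
        using 1 by (intro bind_cong_length) (simp add: Cons additive_ser_shift)
      also have "\<dots> = coeff (subst a (subst b c)) bs"
        by (simp add: Cons shift_subst flip: coeff_shift)
      finally show ?thesis .
    qed
  qed
qed

definition ident :: "('b::ab_group_add, 'b) ser" where
  "ident = Ser (\<lambda>bs. case bs of [b] \<Rightarrow> b | _ \<Rightarrow> 0)"

lemma coeff_ident_Nil [simp]: "coeff ident [] = 0"
  by (simp add: ident_def)

lemma shift_ident: "shift ident b = const b"
  by (rule ser_eqI) (simp add: ident_def coeff_const split: list.split)

lemma subst_ident_left: "subst ident a = a" if "coeff a [] = 0"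
  by (rule ser_eq_shiftI) (simp_all add: that shift_subst shift_ident subst_const bind_const_right)

lemma subst_ident_right: "subst a ident = a" if "additive_ser a"
proof (rule ser_eqI)
  fix bs
  show "coeff (subst a ident) bs = coeff a bs"
    using that
  proof (induction bs arbitrary: a)
    case (Cons b bs)
    have "shift a 0 = 0"
      using additive_0[of "shift a"] additive_ser_shift_add[OF Cons.prems] by blast
    then have "subst (shift a 0) ident = 0"
      by (auto intro!: ser_eqI simp: coeff_subst)
    then have "shift (subst a ident) b = subst (shift a b) ident"
      by (simp add: shift_subst shift_ident bind_const)
    then show ?case
      using Cons by (metis additive_ser_shift coeff_shift)
  qed simp
qed

section \<open>Formal multilinear function series as word series\<close>

lemma Ser_mul_add: "Ser (\<alpha> \<oplus> \<beta>) = Ser \<alpha> + Ser \<beta>"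
  by (rule ser_eqI) (simp add: mul_add_def)

lemma Ser_mul_prod: "Ser (\<alpha> \<odot> \<beta>) = Ser \<alpha> * Ser \<beta>"
proof (rule ser_eqI)
  fix bs :: "'a list"
  have "bij_betw (\<lambda>k. (take k bs, drop k bs)) {0..length bs} (splits bs)"
    by (rule bij_betw_byWitness[where f' = "\<lambda>(us, vs). length us"]) (auto simp: splits_def)
  then show "coeff (Ser (\<alpha> \<odot> \<beta>)) bs = coeff (Ser \<alpha> * Ser \<beta>) bs"
    by (simp add: mul_prod_def coeff_mult case_prod_unfold flip: sum.reindex_bij_betw)
qed

lemma Ser_mul_one: "Ser mul_one = 1"
  by (rule ser_eqI) (simp add: mul_one_def coeff_1 split: list.split)

lemma Ser_mul_id: "Ser mul_id = ident"
  by (simp add: mul_id_def ident_def)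

text \<open>
  The blocks of \<open>bs\<close> with the lengths \<open>ps\<close>, in the form in which they occur in the definition
  of the formal composition.
\<close>

definition chop :: "nat list \<Rightarrow> 'b list \<Rightarrow> 'b list list" where
  "chop ps bs = map (\<lambda>j. take (ps ! j) (drop (sum_list (take j ps)) bs)) [0..<length ps]"

lemma chop_Nil [simp]: "chop [] bs = []"
  by (simp add: chop_def)

lemma chop_Cons [simp]: "chop (p # ps) bs = take p bs # chop ps (drop p bs)"
  by (simp add: chop_def map_upt_Suc add.commute del: upt_Suc)

lemma chop_lengths: "chop (map length css) (concat css) = css"
  by (induction css) auto

lemma concat_chop: "sum_list ps = length bs \<Longrightarrow> concat (chop ps bs) = bs"
  by (induction ps arbitrary: bs) auto

lemma lengths_chop: "sum_list ps = length bs \<Longrightarrow> map length (chop ps bs) = ps"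
  by (induction ps arbitrary: bs) auto

lemma bij_betw_lengths_parts:
  "bij_betw (\<lambda>ps. chop ps bs) {ps. (\<forall>p\<in>set ps. p \<ge> 1) \<and> sum_list ps = length bs} (parts bs)"
proof (rule bij_betw_byWitness[where f' = "map length"])
  show "(\<lambda>ps. chop ps bs) ` {ps. (\<forall>p\<in>set ps. p \<ge> 1) \<and> sum_list ps = length bs} \<subseteq> parts bs"
  proof clarify
    fix ps :: "nat list" assume ps: "\<forall>p\<in>set ps. p \<ge> 1" "sum_list ps = length bs"
    have "[] \<notin> set (chop ps bs)"
    proof
      assume "[] \<in> set (chop ps bs)"
      then have "0 \<in> set (map length (chop ps bs))" by force
      then show False using ps lengths_chop by fastforce
    qed
    then show "chop ps bs \<in> parts bs"
      using ps by (simp add: parts_def concat_chop)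
  qed
  show "map length ` parts bs \<subseteq> {ps. (\<forall>p\<in>set ps. p \<ge> 1) \<and> sum_list ps = length bs}"
    by (auto simp: parts_def length_concat Suc_le_eq)
qed (auto simp: lengths_chop chop_lengths parts_def)

lemma length_le_sum_list: "(\<forall>p\<in>set ps. p \<ge> 1) \<Longrightarrow> length ps \<le> sum_list (ps :: nat list)"
  by (induction ps) fastforce+

lemma Ser_mul_comp: "Ser (\<alpha> \<circledcirc> \<beta>) = subst (Ser \<alpha>) (Ser \<beta>)"
proof (rule ser_eqI)
  fix bs :: "'a list"
  let ?P = "{ps. (\<forall>p\<in>set ps. p \<ge> 1) \<and> sum_list ps = length bs}"
  show "coeff (Ser (\<alpha> \<circledcirc> \<beta>)) bs = coeff (subst (Ser \<alpha>) (Ser \<beta>)) bs"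
  proof (cases "bs = []")
    case True
    then show ?thesis by (simp add: mul_comp_def)
  next
    case False
    have fin: "finite ?P"
      using bij_betw_finite[OF bij_betw_lengths_parts[of bs]] by simp
    have "length ps \<in> {1..length bs}" if "ps \<in> ?P" for ps
    proof -
      have "length ps \<le> sum_list ps"
        using that length_le_sum_list[of ps] by simp
      then show ?thesis using that False by (cases ps) auto
    qed
    then have "(\<Sum>k=1..length bs. \<Sum>ps | ps \<in> ?P \<and> length ps = k. \<alpha> (map \<beta> (chop ps bs))) =
        (\<Sum>ps\<in>?P. \<alpha> (map \<beta> (chop ps bs)))"
      using sum.group[OF fin, of "{1..length bs}" length "\<lambda>ps. \<alpha> (map \<beta> (chop ps bs))"] by blast
    also have "\<dots> = (\<Sum>css\<in>parts bs. \<alpha> (map \<beta> css))"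
      by (rule sum.reindex_bij_betw[OF bij_betw_lengths_parts])
    finally show ?thesis using False
      by (simp add: mul_comp_def coeff_subst chop_def comp_def conj_ac cong: conj_cong)
  qed
qed

section \<open>Inverses for the product\<close>

text \<open>
  The geometric series \<open>1 + u + u\<^sup>2 + \<dots>\<close> for a \<open>u\<close> without constant term: a word contributes the product of
  the values of \<open>u\<close> over the blocks, summed over all decompositions into blocks. Written as a
  substitution into the multilinear series \<open>prod_list\<close>, it inherits multilinearity.
\<close>

definition geo :: "('b, 'v::{ring, monoid_mult}) ser \<Rightarrow> ('b, 'v) ser" where
  "geo u = subst (Ser prod_list) u"

lemma shift_mult: "shift (a * b) c = shift a c * b + smult (coeff a []) (shift b c)"
  by (rule ser_eqI) (simp add: coeff_mult sum_splits_Cons)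

lemma shift_add: "shift (a + b) c = shift a c + shift b c"
  by (rule ser_eqI) simp

lemma shift_one: "shift 1 c = 0"
  by (simp add: one_eq_const)

lemma geo_unfold:
  fixes u :: "('b, 'v::{ring, monoid_mult}) ser"
  assumes "coeff u [] = 0"
  shows "geo u = 1 + u * geo u"
proof (rule ser_eq_shiftI)
  fix b :: 'b
  have "shift (Ser prod_list) c = smult c (Ser prod_list)" for c :: 'v
    by (rule ser_eqI) simp
  then have "shift (geo u) b = shift u b * geo u"
    by (simp add: geo_def shift_subst smult_subst times_ser_def)
  also have "\<dots> = shift (1 + u * geo u) b"
    by (rule ser_eqI) (simp add: shift_add shift_one shift_mult assms del: coeff_shift)
  finally show "shift (geo u) b = shift (1 + u * geo u) b" .
qed (simp add: geo_def assms coeff_1)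

lemma coeff_geo_Nil [simp]: "coeff (geo u) [] = 1"
  by (simp add: geo_def)

lemma geo_inverse:
  assumes "coeff u [] = 0"
  shows "(1 - u) * geo u = 1" "geo u * (1 - u) = 1"
proof -
  show right: "(1 - u) * geo u = 1"
    using geo_unfold[OF assms] by (simp add: left_diff_distrib diff_eq_eq)
  \<comment> \<open>A right inverse with constant term 1 is itself of the form \<open>1 - w\<close> and so has a
      right inverse, which forces it to be two-sided.\<close>
  define w where "w = - (u * geo u)"
  have "geo u = 1 - w" "coeff w [] = 0"
    using geo_unfold[OF assms] assms by (simp_all add: w_def)
  then have w: "geo u * geo w = 1"
    using geo_unfold[of w] by (simp add: left_diff_distrib diff_eq_eq)
  have "1 - u = (1 - u) * (geo u * geo w)" by (simp add: w)
  also have "\<dots> = geo w" by (simp add: right flip: mult.assoc)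
  finally show "geo u * (1 - u) = 1" using w by simp
qed

section \<open>Multilinear series\<close>

definition multilinear :: "('k::field \<Rightarrow> 'b::ab_group_add \<Rightarrow> 'b) \<Rightarrow> ('b, 'b) ser \<Rightarrow> bool" where
  "multilinear scale a \<longleftrightarrow> (\<forall>us vs. Vector_Spaces.linear scale scale (\<lambda>b. coeff a (us @ b # vs)))"

lemma Mul_iff_multilinear: "\<alpha> \<in> Mul scale \<longleftrightarrow> multilinear scale (Ser \<alpha>)"
proof
  assume L: "\<alpha> \<in> Mul scale"
  show "multilinear scale (Ser \<alpha>)"
    unfolding multilinear_def
  proof (intro allI)
    fix us vs :: "'a list"
    have "length us < length (us @ 0 # vs)" by simp
    then have "Vector_Spaces.linear scale scale (\<lambda>b. \<alpha> ((us @ 0 # vs)[length us := b]))"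
      using L unfolding Mul_def by blast
    then show "Vector_Spaces.linear scale scale (\<lambda>b. coeff (Ser \<alpha>) (us @ b # vs))" by simp
  qed
qed (simp add: Mul_def multilinear_def upd_conv_take_nth_drop)

lemma multilinear_additive: "multilinear scale a \<Longrightarrow> additive_ser a"
  unfolding multilinear_def additive_ser_def Vector_Spaces.linear_iff by blast

lemma multilinear_shift: "multilinear scale a \<Longrightarrow> multilinear scale (shift a c)"
  unfolding multilinear_def coeff_shift append_Cons[symmetric] by blast

context unital_algebra
begin

abbreviation lin :: "('b \<Rightarrow> 'b) \<Rightarrow> bool" where "lin \<equiv> Vector_Spaces.linear scale scale"

lemma lin_iff: "lin f \<longleftrightarrow> (\<forall>x y. f (x + y) = f x + f y) \<and> (\<forall>c x. f (scale c x) = scale c (f x))"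
  by (simp add: Vector_Spaces.linear_iff vector_space_axioms)

lemma lin_sum: "(\<And>i. i \<in> S \<Longrightarrow> lin (f i)) \<Longrightarrow> lin (\<lambda>x. \<Sum>i\<in>S. f i x)"
  by (simp add: lin_iff sum.distrib scale_sum_right)

lemma lin_comp: "lin f \<Longrightarrow> lin g \<Longrightarrow> lin (\<lambda>x. f (g x))"
  by (simp add: lin_iff)

lemma lin_add: "lin f \<Longrightarrow> lin g \<Longrightarrow> lin (\<lambda>x. f x + g x)"
  by (simp add: lin_iff scale_right_distrib)

lemma lin_mult_left: "lin f \<Longrightarrow> lin (\<lambda>x. c * f x)" and lin_mult_right: "lin f \<Longrightarrow> lin (\<lambda>x. f x * c)"
  by (simp_all add: lin_iff algebra_simps flip: scale_mult_left scale_mult_right)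

lemma multilinear_add: "multilinear scale a \<Longrightarrow> multilinear scale b \<Longrightarrow> multilinear scale (a + b)"
  by (simp add: multilinear_def lin_add)

lemma multilinear_diff: "multilinear scale a \<Longrightarrow> multilinear scale b \<Longrightarrow> multilinear scale (a - b)"
  by (simp add: multilinear_def lin_iff scale_right_diff_distrib)

lemma multilinear_uminus: "multilinear scale a \<Longrightarrow> multilinear scale (- a)"
  by (simp add: multilinear_def lin_iff scale_minus_right)

lemma multilinear_ident: "multilinear scale ident"
  unfolding multilinear_def
proof (intro allI)
  fix us vs :: "'b list"
  show "lin (\<lambda>b. coeff ident (us @ b # vs))"
    by (cases us; cases vs; cases "tl us") (simp_all add: lin_iff ident_def)
qed

lemma multilinear_prod_list: "multilinear scale (Ser prod_list)"
  by (simp add: multilinear_def lin_iff algebra_simps flip: scale_mult_left scale_mult_right)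

lemma multilinear_mult:
  assumes "multilinear scale a" "multilinear scale b"
  shows "multilinear scale (a * b)"
proof -
  have a: "lin (\<lambda>x. coeff a (us @ x # vs))" and b: "lin (\<lambda>x. coeff b (us @ x # vs))" for us vs
    using assms by (simp_all add: multilinear_def)
  show ?thesis
    unfolding multilinear_def coeff_mult sum_splits_middle
    unfolding case_prod_unfold
    by (intro allI lin_add lin_sum lin_mult_left[OF b] lin_mult_right[OF a])
qed

text \<open>
  A letter of the word is read either inside the first block, where linearity of \<open>a\<close> in its first argument and
  linearity of \<open>b\<close> combine, or in the remaining word, which is shorter.
\<close>

lemma multilinear_subst:
  assumes "multilinear scale a" "multilinear scale b"
  shows "multilinear scale (subst a b)"
proof -
  have first: "lin (\<lambda>c. coeff (subst (shift a c) b) bs)" if "multilinear scale a" for a bs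
  proof -
    have "lin (\<lambda>c. coeff a ([] @ c # vs))" for vs
      using that unfolding multilinear_def by blast
    then show ?thesis
      unfolding coeff_subst coeff_shift by (intro lin_sum) simp
  qed
  have "lin (\<lambda>x. coeff (subst a b) (us @ x # vs))" for us vs
    using assms(1)
  proof (induction us arbitrary: a vs rule: length_induct)
    case (1 us)
    have b: "lin (\<lambda>x. coeff b (us @ x # vs))" for us vs
      using assms(2) by (simp add: multilinear_def)
    have hit: "lin (\<lambda>x. coeff (subst (shift a (coeff b (us @ x # p))) b) q)" for us p q
      by (rule lin_comp[OF first[OF 1(2)] b])
    show ?case
    proof (cases us)
      case Nil
      have "coeff (subst a b) (us @ x # vs) =
          (\<Sum>(p, q)\<in>splits vs. coeff (subst (shift a (coeff b ([] @ x # p))) b) q)" for x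
        using arg_cong[OF shift_subst[of a b x], of "\<lambda>s. coeff s vs"]
        by (simp add: Nil coeff_bind)
      then show ?thesis
        using hit[of "[]"] by (simp add: case_prod_unfold lin_sum)
    next
      case (Cons u us')
      have "coeff (subst a b) (us @ x # vs) =
          (\<Sum>(p, q)\<in>splits us'. coeff (subst (shift a (coeff b (u # p))) b) (q @ x # vs)) +
          (\<Sum>(p, q)\<in>splits vs. coeff (subst (shift a (coeff b (us @ x # p))) b) q)" for x
        using arg_cong[OF shift_subst[of a b u], of "\<lambda>s. coeff s (us' @ x # vs)"]
        by (simp add: Cons coeff_bind sum_splits_middle)
      moreover have "lin (\<lambda>x. coeff (subst (shift a c) b) (snd i @ x # vs))"
        if "i \<in> splits us'" for c i
        using 1 that splits_length[of "fst i" "snd i" us'] by (simp add: Cons multilinear_shift less_Suc_eq_le)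
      then have "lin (\<lambda>x. \<Sum>(p, q)\<in>splits us'. coeff (subst (shift a (coeff b (u # p))) b) (q @ x # vs))"
        unfolding case_prod_unfold by (rule lin_sum)
      moreover have "lin (\<lambda>x. \<Sum>(p, q)\<in>splits vs. coeff (subst (shift a (coeff b (us @ x # p))) b) q)"
        unfolding case_prod_unfold by (intro lin_sum hit)
      ultimately show ?thesis
        by (simp add: lin_add)
    qed
  qed
  then show ?thesis by (simp add: multilinear_def)
qed

lemma multilinear_geo: "multilinear scale u \<Longrightarrow> multilinear scale (geo u)"
  by (simp add: geo_def multilinear_subst multilinear_prod_list)

lemma mul_inverse_eq:
  assumes "multilinear scale v" "v * Ser \<alpha> = 1" "Ser \<alpha> * v = 1"
  shows "Ser (mul_inverse scale \<alpha>) = v"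
proof -
  have "mul_inverse scale \<alpha> = coeff v"
    unfolding mul_inverse_def
  proof (rule the_equality)
    have "Ser (coeff v \<odot> \<alpha>) = Ser mul_one" "Ser (\<alpha> \<odot> coeff v) = Ser mul_one"
      using assms by (simp_all add: Ser_mul_prod Ser_mul_one coeff_inverse)
    then show "coeff v \<in> Mul scale \<and> coeff v \<odot> \<alpha> = mul_one \<and> \<alpha> \<odot> coeff v = mul_one"
      using assms by (simp add: Mul_iff_multilinear coeff_inverse Ser_inject)
  next
    fix \<gamma> assume "\<gamma> \<in> Mul scale \<and> \<gamma> \<odot> \<alpha> = mul_one \<and> \<alpha> \<odot> \<gamma> = mul_one"
    then have "Ser \<gamma> * Ser \<alpha> = 1"
      by (simp flip: Ser_mul_prod Ser_mul_one)
    then have "Ser \<gamma> * (Ser \<alpha> * v) = v"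
      by (simp flip: mult.assoc)
    then have "Ser \<gamma> = v"
      by (simp add: assms(3))
    then show "\<gamma> = coeff v"
      using coeff_Ser[of \<gamma>] by simp
  qed
  then show ?thesis by (simp add: coeff_inverse)
qed

end

section \<open>Inverses for the composition\<close>

lemma parts_length_less:
  assumes "css \<in> parts bs" "cs \<in> set css" "css \<noteq> [cs]"
  shows "length cs < length bs"
proof -
  obtain xs ys where css: "css = xs @ cs # ys"
    using assms(2) by (meson split_list)
  have "concat xs \<noteq> [] \<or> concat ys \<noteq> []"
    using assms unfolding css parts_def by (cases xs; cases ys) auto
  then show ?thesis
    using assms(1) by (auto simp: css parts_def)
qed

text \<open>
  Without terms of order at most one in \<open>n\<close>, every contributing decomposition has at least two blocks,
  so only words strictly shorter than \<open>bs\<close> are passed to the inner series. This makes the fixed point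
  iteration below stabilize.
\<close>

lemma coeff_subst_cong:
  assumes "coeff n [] = 0" "\<And>b. coeff n [b] = 0"
    and "\<And>cs. length cs < length bs \<Longrightarrow> coeff a cs = coeff b cs"
  shows "coeff (subst n a) bs = coeff (subst n b) bs"
  unfolding coeff_subst
proof (rule sum.cong)
  fix css assume css: "css \<in> parts bs"
  show "coeff n (map (coeff a) css) = coeff n (map (coeff b) css)"
  proof (cases "\<exists>cs. css = [cs]")
    case True
    then show ?thesis by (auto simp: assms)
  next
    case False
    then have "coeff a cs = coeff b cs" if "cs \<in> set css" for cs
      using css that by (auto intro!: assms(3) parts_length_less)
    then have "map (coeff a) css = map (coeff b) css" by simp
    then show ?thesis by (simp only:)
  qed
qed simp

text \<open>
  A right inverse of \<open>ident + n\<close> is a fixed point of \<open>c \<mapsto> ident - subst n c\<close>. The \<open>k\<close>-th iterate is correct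
  on words of length up to \<open>k\<close>.
\<close>

primrec comp_iter :: "('b::ab_group_add, 'b) ser \<Rightarrow> nat \<Rightarrow> ('b, 'b) ser" where
  "comp_iter n 0 = ident"
| "comp_iter n (Suc k) = ident - subst n (comp_iter n k)"

definition comp_limit :: "('b::ab_group_add, 'b) ser \<Rightarrow> ('b, 'b) ser" where
  "comp_limit n = Ser (\<lambda>bs. coeff (comp_iter n (length bs)) bs)"

lemma coeff_comp_iter:
  assumes n: "coeff n [] = 0" "\<And>b. coeff n [b] = 0"
    and "length bs \<le> k"
  shows "coeff (comp_iter n k) bs = coeff (comp_limit n) bs"
proof -
  have "coeff (comp_iter n l) bs = coeff (comp_iter n k) bs" if "length bs \<le> k" "k \<le> l" for k l bs
    using that
  proof (induction k arbitrary: l bs)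
    case 0
    then show ?case by (cases l) (auto simp: n)
  next
    case (Suc k)
    then obtain l' where l': "l = Suc l'" "k \<le> l'"
      by (cases l) auto
    have "coeff (subst n (comp_iter n l')) bs = coeff (subst n (comp_iter n k)) bs"
    proof (intro coeff_subst_cong n)
      fix cs :: "'a list" assume "length cs < length bs"
      then show "coeff (comp_iter n l') cs = coeff (comp_iter n k) cs"
        using Suc.prems l' by (intro Suc.IH) simp_all
    qed
    then show ?case by (simp add: l')
  qed
  from this[of bs "length bs" k] show ?thesis
    using assms(3) by (simp add: comp_limit_def)
qed

lemma comp_limit_unfold:
  assumes n: "coeff n [] = 0" "\<And>b. coeff n [b] = 0"
  shows "comp_limit n = ident - subst n (comp_limit n)"
proof (rule ser_eqI)
  fix bs
  have "coeff (comp_limit n) bs = coeff (comp_iter n (Suc (length bs))) bs"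
    using coeff_comp_iter[OF n, of bs "Suc (length bs)"] by simp
  also have "\<dots> = coeff (ident - subst n (comp_limit n)) bs"
    using coeff_subst_cong[OF n, of bs "comp_iter n (length bs)" "comp_limit n"]
      coeff_comp_iter[OF n] by simp
  finally show "coeff (comp_limit n) bs = coeff (ident - subst n (comp_limit n)) bs" .
qed

context unital_algebra
begin

lemma multilinear_comp_limit:
  assumes "multilinear scale n"
  shows "multilinear scale (comp_limit n)"
proof -
  have "multilinear scale (comp_iter n k)" for k
    by (induction k) (simp_all add: multilinear_ident multilinear_diff multilinear_subst assms)
  then have "lin (\<lambda>b. coeff (comp_iter n (Suc (length us + length vs))) (us @ b # vs))" for us vs
    by (simp only: multilinear_def)
  then show ?thesis
    by (simp add: multilinear_def comp_limit_def del: comp_iter.simps)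
qed

text \<open>
  The multilinear series of this shape form a group under composition. The series
  to be inverted in the R-transform is one of them.
\<close>

definition unipotent :: "('b, 'b) ser \<Rightarrow> bool" where
  "unipotent a \<longleftrightarrow> multilinear scale a \<and> coeff a [] = 0 \<and> (\<forall>b. coeff a [b] = b)"

lemma unipotent_right_inverse:
  assumes "unipotent a"
  obtains c where "unipotent c" "subst a c = ident"
proof
  define n where "n = a - ident"
  have n: "coeff n [] = 0" "\<And>b. coeff n [b] = 0" and ml: "multilinear scale n"
    using assms by (simp_all add: n_def unipotent_def ident_def multilinear_diff multilinear_ident[unfolded ident_def])
  let ?c = "comp_limit n"
  have c0: "coeff ?c [] = 0"
    by (simp add: comp_limit_def)
  have "coeff (subst n ?c) [b] = 0" for b
    using n by (simp add: coeff_subst sum_parts_Cons)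
  then have "coeff ?c [b] = b" for b
    by (subst comp_limit_unfold[OF n]) (simp add: ident_def)
  then show "unipotent ?c"
    using c0 multilinear_comp_limit[OF ml] by (simp add: unipotent_def)
  have "subst a ?c = subst (ident + n) ?c"
    by (simp add: n_def)
  also have "\<dots> = ?c + subst n ?c"
    by (simp add: subst_add subst_ident_left c0)
  also have "\<dots> = ident"
    by (metis comp_limit_unfold[OF n] diff_add_cancel)
  finally show "subst a ?c = ident" .
qed

text \<open>
  A monoid in which every element has a right inverse is a group.
\<close>

lemma unipotent_inverse:
  assumes "unipotent a"
  obtains c where "unipotent c" "subst a c = ident" "subst c a = ident"
proof -
  obtain c where c: "unipotent c" "subst a c = ident"
    using unipotent_right_inverse[OF assms] .
  obtain d where d: "unipotent d" "subst c d = ident"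
    using unipotent_right_inverse[OF c(1)] .
  have add: "additive_ser a" "coeff d [] = 0"
    using assms d by (simp_all add: unipotent_def multilinear_additive[of scale])
  have "a = subst a (subst c d)"
    by (simp add: d subst_ident_right add)
  also have "\<dots> = d"
    by (simp add: c add subst_ident_left flip: subst_assoc)
  finally show ?thesis using c d that by simp
qed

lemma mul_comp_inverse_eq:
  assumes "unipotent (Ser \<alpha>)" "multilinear scale f" "coeff f [] = 0" "subst (Ser \<alpha>) f = ident"
  shows "Ser (mul_comp_inverse scale \<alpha>) = f"
proof -
  obtain c where c: "unipotent c" "subst (Ser \<alpha>) c = ident" "subst c (Ser \<alpha>) = ident"
    using unipotent_inverse[OF assms(1)] .
  have unique: "g = c" if "coeff g [] = 0" "subst (Ser \<alpha>) g = ident" for g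
  proof -
    have "additive_ser c"
      using c by (simp add: unipotent_def multilinear_additive[of scale])
    then have "c = subst c (subst (Ser \<alpha>) g)"
      by (simp add: that subst_ident_right)
    also have "\<dots> = g"
      using \<open>additive_ser c\<close> by (simp add: c subst_ident_left[OF that(1)] flip: subst_assoc)
    finally show ?thesis ..
  qed
  have f: "f = c"
    using assms unique by blast
  have "mul_comp_inverse scale \<alpha> = coeff f"
    unfolding mul_comp_inverse_def
  proof (rule the_equality)
    have "Ser (coeff f \<circledcirc> \<alpha>) = Ser mul_id" "Ser (\<alpha> \<circledcirc> coeff f) = Ser mul_id"
      using c by (simp_all add: Ser_mul_comp Ser_mul_id coeff_inverse f)
    then show "coeff f \<in> Mul scale \<and> coeff f [] = 0 \<and> coeff f \<circledcirc> \<alpha> = mul_id \<and> \<alpha> \<circledcirc> coeff f = mul_id"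
      using assms by (simp add: Mul_iff_multilinear coeff_inverse Ser_inject)
  next
    fix \<gamma> assume "\<gamma> \<in> Mul scale \<and> \<gamma> [] = 0 \<and> \<gamma> \<circledcirc> \<alpha> = mul_id \<and> \<alpha> \<circledcirc> \<gamma> = mul_id"
    then have "subst (Ser \<alpha>) (Ser \<gamma>) = ident" "coeff (Ser \<gamma>) [] = 0"
      by (simp_all flip: Ser_mul_comp Ser_mul_id)
    then have "Ser \<gamma> = f"
      using unique f by blast
    then show "\<gamma> = coeff f"
      using coeff_Ser[of \<gamma>] by simp
  qed
  then show ?thesis by (simp add: coeff_inverse)
qed

end

section \<open>The R-transform as the solution of a functional equation\<close>

text \<open>
  Although \<open>ident\<close> need not be invertible, it can be cancelled: evaluate at a word that starts with 1.
\<close>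

lemma ident_left_cancel: "ident * a = ident * b \<Longrightarrow> a = b" for a b :: "('b::{ring, monoid_mult}, 'b) ser"
proof (rule ser_eqI)
  fix bs
  assume "ident * a = ident * b"
  then have "coeff (shift (ident * a) 1) bs = coeff (shift (ident * b) 1) bs"
    by simp
  then show "coeff a bs = coeff b bs"
    by (simp add: shift_mult shift_ident const_mult del: coeff_shift)
qed

text \<open>
  Formally, \<open>f = (g\<^sup>-\<^sup>1 + r)\<^sup>-\<^sup>1\<close> for \<open>g = ident\<close>; the equation \<open>(1 + g r) f = g\<close> expresses this
  without an inverse of \<open>g\<close>. In the second equation \<open>1 + ident * b\<close> plays the part of the
  expected resolvent.
\<close>

definition R_equation :: "('b::{ring, monoid_mult}, 'b) ser \<Rightarrow> ('b, 'b) ser \<Rightarrow> ('b, 'b) ser \<Rightarrow> bool" where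
  "R_equation b r f \<longleftrightarrow> (1 + ident * r) * f = ident \<and> subst (1 + ident * b) f = 1 + ident * r"

context unital_algebra
begin

lemma unipotent_moment_series: "unipotent (ident + ident * b * ident)" if "multilinear scale b"
proof -
  have "coeff (ident * b * ident) [c] = 0" for c :: 'b
    by (simp add: coeff_mult sum_splits_Cons)
  then show ?thesis
    using that by (simp add: unipotent_def multilinear_add multilinear_mult multilinear_ident)
       (simp add: ident_def)
qed

lemma R_transform_eq_subst:
  assumes b: "multilinear scale b"
    and f: "multilinear scale f" "coeff f [] = 0" "subst (ident + ident * b * ident) f = ident"
  shows "Ser (R_transform scale (coeff b)) = subst (geo (- (b * ident)) * b) f"
proof -
  let ?u = "- (b * ident)"
  have "multilinear scale (geo ?u)"
    by (intro multilinear_geo multilinear_uminus multilinear_mult b multilinear_ident)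
  then have inv: "Ser (mul_inverse scale (mul_one \<oplus> coeff b \<odot> mul_id)) = geo ?u"
    using geo_inverse[of ?u]
    by (intro mul_inverse_eq) (simp_all add: Ser_mul_add Ser_mul_one Ser_mul_prod Ser_mul_id coeff_inverse)
  have "Ser (mul_comp_inverse scale (mul_id \<oplus> mul_id \<odot> coeff b \<odot> mul_id)) = f"
    using unipotent_moment_series[OF b] f
    by (intro mul_comp_inverse_eq) (simp_all add: Ser_mul_add Ser_mul_prod Ser_mul_id coeff_inverse)
  then show ?thesis
    by (simp add: R_transform_def Ser_mul_comp Ser_mul_prod inv coeff_inverse)
qed

lemma subst_geo_inverse:
  assumes "coeff u [] = 0"
  shows "subst (1 - u) f * subst (geo u) f = 1" "subst (geo u) f * subst (1 - u) f = 1"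
  by (simp_all only: geo_inverse[OF assms] subst_one flip: subst_mult)

lemma moment_series_factor: "ident + ident * b * ident = (1 + ident * b) * ident" for b :: "('b, 'b) ser"
  by (simp add: distrib_right)

text \<open>
  Multiplying the second equation on the right by \<open>f\<close> shows that \<open>f\<close> is the compositional inverse in
  the definition of the R-transform. Comparing the two equations gives \<open>b \<circ> f = r (1 + g r)\<close>, where
  \<open>g = ident\<close>, and hence \<open>1 + (b \<circ> f) f = 1 + r g\<close>, after which the R-transform simplifies to \<open>r\<close>.
\<close>

lemma R_transform_unique:
  assumes b: "multilinear scale b" and f: "multilinear scale f" and eq: "R_equation b r f"
  shows "Ser (R_transform scale (coeff b)) = r"
proof -
  let ?g = "ident" and ?b = "subst b f" and ?w = "subst (geo (- (b * ident))) f"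
  have eq1: "(1 + ?g * r) * f = ?g" and eq2: "subst (1 + ?g * b) f = 1 + ?g * r"
    using eq by (simp_all add: R_equation_def)
  have f0: "coeff f [] = 0"
    using arg_cong[OF eq1, of "\<lambda>s. coeff s []"] by (simp add: coeff_1)
  note sub = subst_add subst_mult subst_one subst_ident_left[OF f0]
  have fb: "f * ?b = ?g * r"
    using eq2 by (simp add: sub)
  have "(1 + ?g * r) * (f * ?b) = ?g * ?b"
    by (simp add: eq1 flip: mult.assoc)
  then have "?g * ?b = ?g * (r * (1 + ?g * r))"
    by (simp add: fb algebra_simps)
  then have b': "?b = r * (1 + ?g * r)"
    by (rule ident_left_cancel)
  have bf: "1 + ?b * f = 1 + r * ?g"
    by (simp add: b' mult.assoc eq1)
  have "subst (ident + ident * b * ident) f = ident"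
    by (simp only: moment_series_factor subst_mult eq2 eq1 subst_ident_left[OF f0])
  then have "Ser (R_transform scale (coeff b)) = ?w * ?b"
    by (simp add: R_transform_eq_subst[OF b f f0] subst_mult)
  also have "\<dots> = ?w * (1 + ?b * f) * r"
    by (simp add: bf) (simp add: b' algebra_simps)
  also have "?w * (1 + ?b * f) = 1"
    using subst_geo_inverse(2)[of "- (b * ident)" f] by (simp add: sub)
  finally show ?thesis by simp
qed

text \<open>
  With \<open>f\<close> the compositional inverse, the defining equation reads \<open>f (1 + (b \<circ> f) f) = g\<close>. The R-transform is
  \<open>r = (1 + (b \<circ> f) f)\<^sup>-\<^sup>1 (b \<circ> f)\<close>, so that \<open>g r = f (b \<circ> f)\<close>; both equations follow.
\<close>

lemma R_transform_equation:
  assumes b: "multilinear scale b"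
  obtains f where "multilinear scale f" "multilinear scale (Ser (R_transform scale (coeff b)))"
    "R_equation b (Ser (R_transform scale (coeff b))) f"
proof -
  obtain f where f: "unipotent f" "subst (ident + ident * b * ident) f = ident"
    using unipotent_inverse[OF unipotent_moment_series[OF b]] by metis
  then have ml: "multilinear scale f" and f0: "coeff f [] = 0"
    by (simp_all add: unipotent_def)
  note sub = subst_add subst_mult subst_one subst_ident_left[OF f0]
  let ?r = "Ser (R_transform scale (coeff b))" and ?b = "subst b f" and ?w = "subst (geo (- (b * ident))) f"
  have r: "?r = subst (geo (- (b * ident)) * b) f"
    by (rule R_transform_eq_subst[OF b ml f0 f(2)])
  have mlr: "multilinear scale ?r"
    unfolding r
    by (intro multilinear_subst multilinear_geo multilinear_uminus multilinear_mult b ml multilinear_ident)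
  have g: "f + f * ?b * f = ident"
    using f(2) by (simp add: sub)
  have w: "(1 + ?b * f) * ?w = 1"
    using subst_geo_inverse(1)[of "- (b * ident)" f] by (simp add: sub)
  have "ident * ?r = f * ((1 + ?b * f) * ?w) * ?b"
    by (simp add: r sub flip: g) (simp add: algebra_simps)
  then have gr: "ident * ?r = f * ?b"
    by (simp add: w)
  have "R_equation b ?r f"
    unfolding R_equation_def gr using g by (simp add: sub distrib_right)
  then show ?thesis using that ml mlr by blast
qed

end

section \<open>Resolvents in a noncommutative probability space\<close>

lemma left_right_inverse_eq:
  fixes s c d :: "'c::monoid_mult"
  assumes "c * s = 1" "s * d = 1"
  shows "c = d"
  using mult.assoc[of c s d] by (simp add: assms)

lemma mult_right_inverse_eq_1_iff:
  fixes m h p :: "'c::monoid_mult"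
  assumes "p * h = 1" "h * p = 1"
  shows "m * h = 1 \<longleftrightarrow> m = p"
  using mult.assoc[of m h p] by (auto simp: assms)

context valued_ncps
begin

lemma emb_add: "emb (b + c) = emb b + emb c" and emb_scale: "emb (scaleB k b) = scaleA k (emb b)"
  using emb_linear by (simp_all add: Vector_Spaces.linear_iff)

lemma E_add: "E (a + b) = E a + E b" and E_scale: "E (scaleA k a) = scaleB k (E a)"
  using E_linear by (simp_all add: Vector_Spaces.linear_iff)

lemma emb_0: "emb 0 = 0" and E_0: "E 0 = 0"
  by (simp_all add: additive_0 emb_add E_add)

lemma emb_sum: "emb (sum f S) = (\<Sum>i\<in>S. emb (f i))" and E_sum: "E (sum g S') = (\<Sum>i\<in>S'. E (g i))"
  by (simp_all add: additive_sum emb_add E_add)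

lemma E_one: "E 1 = 1"
  using E_emb[of 1] by (simp add: emb_one)

lemma E_emb_left: "E (emb b * a) = b * E a" and E_emb_right: "E (a * emb b) = E a * b"
  using E_bimodule[of b a 1] E_bimodule[of 1 a b] by (simp_all add: emb_one)

text \<open>
  Coefficientwise inclusion and expectation, between series over \<open>B\<close> and series over \<open>A\<close>.
\<close>

abbreviation up :: "('c, 'b) ser \<Rightarrow> ('c, 'a) ser" where "up \<equiv> map_ser emb"
abbreviation ex :: "('c, 'a) ser \<Rightarrow> ('c, 'b) ser" where "ex \<equiv> map_ser E"

lemma up_add: "up (r + s) = up r + up s"
  by (rule ser_eqI) (simp add: emb_add)

lemma up_mult: "up (r * s) = up r * up s"
  by (rule ser_eqI) (simp add: coeff_mult emb_sum emb_mult case_prod_unfold)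

lemma up_one: "up 1 = 1"
  by (rule ser_eqI) (simp add: coeff_1 emb_one emb_0)

lemma ex_add: "ex (r + s) = ex r + ex s"
  by (rule ser_eqI) (simp add: E_add)

lemma ex_one: "ex 1 = 1"
  by (rule ser_eqI) (simp add: coeff_1 E_one E_0)

lemma ex_up_right: "ex (s * up r) = ex s * r"
  by (rule ser_eqI) (simp add: coeff_mult E_sum E_emb_right case_prod_unfold)

text \<open>
  The expansion of \<open>(1 - g x)\<^sup>-\<^sup>1\<close> with \<open>g = up ident\<close>.
\<close>

definition resolvent :: "'a \<Rightarrow> ('b, 'a) ser" where
  "resolvent x = Ser (\<lambda>bs. prod_list (map (\<lambda>b. emb b * x) bs))"

lemma resolvent_inverse: "(1 - up ident * const x) * resolvent x = 1"
proof -
  define u where "u = up ident * (const x :: ('b, 'a) ser)"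
  have "resolvent x = 1 + u * resolvent x"
  proof (rule ser_eq_shiftI)
    fix b :: 'b
    have "shift (up ident) b = const (emb b)"
      by (rule ser_eqI) (simp add: ident_def coeff_const emb_0 split: list.split)
    then have "shift u b = const (emb b) * const x"
      by (intro ser_eqI) (simp add: u_def shift_mult emb_0 del: coeff_shift)
    moreover have "shift (1 + u * resolvent x) b = shift u b * resolvent x"
      by (rule ser_eqI) (simp add: shift_add shift_one shift_mult u_def emb_0 del: coeff_shift)
    moreover have "shift (resolvent x) b = const (emb b) * (const x * resolvent x)"
      by (rule ser_eqI) (simp add: const_mult, simp add: resolvent_def mult.assoc)
    ultimately show "shift (resolvent x) b = shift (1 + u * resolvent x) b"
      by (simp add: mult.assoc)
  qed (simp add: resolvent_def coeff_1 u_def emb_0)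
  then show ?thesis
    by (simp add: left_diff_distrib diff_eq_eq u_def)
qed

lemma ex_resolvent: "ex (resolvent x) = 1 + ident * Ser (distribution_series emb E x)"
proof (rule ser_eq_shiftI)
  fix b
  have rot: "x * prod_list (map (\<lambda>b. emb b * x) bs) = prod_list (map (\<lambda>b. x * emb b) bs) * x" for bs
    by (induction bs) (simp_all add: mult.assoc)
  have "shift (ex (resolvent x)) b = smult b (Ser (distribution_series emb E x))"
    by (rule ser_eqI) (simp add: resolvent_def distribution_series_def mult.assoc E_emb_left rot)
  then show "shift (ex (resolvent x)) b = shift (1 + ident * Ser (distribution_series emb E x)) b"
    by (simp add: shift_add shift_one shift_mult shift_ident const_mult)
       (rule ser_eqI, simp)
qed (simp add: resolvent_def E_one coeff_1)

lemma multilinear_distribution: "multilinear scaleB (Ser (distribution_series emb E x))"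
  unfolding multilinear_def B.lin_iff
  by (simp add: distribution_series_def algebra_simps emb_add emb_scale E_add E_scale
      flip: A.scale_mult_left A.scale_mult_right)

text \<open>
  The factorization \<open>1 - g (x - r) = (1 + g r) (1 - f x)\<close> reduces the shifted resolvent to the resolvent of \<open>x\<close>
  after substitution of \<open>f\<close>, multiplied on the right by \<open>(1 + g r)\<^sup>-\<^sup>1\<close>. The latter has coefficients in \<open>B\<close> and can be
  taken out of the expectation.
\<close>

lemma ex_geo_eq_one_iff:
  fixes r f :: "('b, 'b) ser"
  assumes f: "(1 + ident * r) * f = ident"
  shows "ex (geo (up ident * (const x - up r))) = 1 \<longleftrightarrow>
    R_equation (Ser (distribution_series emb E x)) r f"
proof -
  let ?u = "up ident * (const x - up r)" and ?p = "1 + ident * r" and ?h = "geo (- (ident * r))"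
  let ?W = "subst (resolvent x) f"
  have f0: "coeff f [] = 0"
    using arg_cong[OF f, of "\<lambda>s. coeff s []"] by (simp add: coeff_1)
  have h: "?p * ?h = 1" "?h * ?p = 1"
    using geo_inverse[of "- (ident * r)"] by simp_all
  have "subst (up ident) f = up f"
    using map_ser_subst[of emb ident f] by (simp add: emb_add subst_ident_left f0)
  then have W: "(1 - up f * const x) * ?W = 1"
    using arg_cong[OF resolvent_inverse[of x], of "\<lambda>s. subst s f"]
    by (simp add: subst_mult subst_diff subst_one subst_const)
  have "1 - ?u = up ?p - up (?p * f) * const x"
    by (simp add: f up_add up_mult up_one right_diff_distrib)
  also have "\<dots> = up ?p * (1 - up f * const x)"
    by (simp add: up_mult right_diff_distrib mult.assoc)
  finally have "(1 - ?u) * (?W * up ?h) = up ?p * (((1 - up f * const x) * ?W) * up ?h)"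
    by (simp add: mult.assoc)
  also have "\<dots> = up (?p * ?h)"
    by (simp only: W up_mult mult_1_left)
  also have "\<dots> = 1"
    by (simp only: h up_one)
  finally have inv: "(1 - ?u) * (?W * up ?h) = 1" .
  have "geo ?u * (1 - ?u) = 1"
    by (rule geo_inverse) (simp add: emb_0)
  then have "geo ?u = ?W * up ?h"
    using inv by (rule left_right_inverse_eq)
  then have "ex (geo ?u) = subst (1 + ident * Ser (distribution_series emb E x)) f * ?h"
    by (simp add: ex_up_right map_ser_subst E_add ex_resolvent)
  then have "ex (geo ?u) = 1 \<longleftrightarrow> subst (1 + ident * Ser (distribution_series emb E x)) f = ?p"
    using mult_right_inverse_eq_1_iff[OF h] by simp
  then show ?thesis
    by (simp add: R_equation_def f)
qed

section \<open>Free series\<close>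

definition over :: "'a set \<Rightarrow> ('c, 'a) ser \<Rightarrow> bool" where
  "over S s \<longleftrightarrow> (\<forall>bs. coeff s bs \<in> S)"

lemma over_closure:
  assumes S: "is_subalgebra scaleA S"
  shows over_one: "over S 1"
    and over_diff: "over S s \<Longrightarrow> over S t \<Longrightarrow> over S (s - t)"
    and over_mult: "over S s \<Longrightarrow> over S t \<Longrightarrow> over S (s * t)"
    and over_geo: "over S s \<Longrightarrow> over S (geo s)"
proof -
  have sub: "A.subspace S" and one: "1 \<in> S" and mult: "\<And>a b. a \<in> S \<Longrightarrow> b \<in> S \<Longrightarrow> a * b \<in> S"
    using S by (auto simp: is_subalgebra_def)
  have prod: "set as \<subseteq> S \<Longrightarrow> prod_list as \<in> S" for as
    by (induction as) (simp_all add: one mult)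
  show "over S 1"
    by (simp add: over_def coeff_1 one A.subspace_0[OF sub])
  show "over S s \<Longrightarrow> over S t \<Longrightarrow> over S (s - t)"
    by (simp add: over_def A.subspace_diff[OF sub])
  show "over S s \<Longrightarrow> over S t \<Longrightarrow> over S (s * t)"
    by (auto simp: over_def coeff_mult intro!: A.subspace_sum[OF sub] mult)
  show "over S s \<Longrightarrow> over S (geo s)"
    by (auto simp: over_def geo_def coeff_subst intro!: A.subspace_sum[OF sub] prod)
qed

text \<open>
  Freeness speaks about elements, and coefficients of a product of series are sums of products of coefficients.
  The series are expanded one at a time; \<open>ws\<close> collects the coefficients chosen so far.
\<close>

lemma free_series_aux:
  assumes free: "free_subalgebras scaleA emb E J S"
    and "list_all2 (\<lambda>i w. w \<in> S i \<and> E w = 0) js ws"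
    and "list_all2 (\<lambda>i s. over (S i) s \<and> ex s = 0) ks ss"
    and "js @ ks \<noteq> []" "set (js @ ks) \<subseteq> J" "distinct_adj (js @ ks)"
  shows "E (prod_list ws * coeff (prod_list ss) bs) = 0"
  using assms(2-)
proof (induction ss arbitrary: js ws ks bs)
  case Nil
  then have "E (prod_list ws) = 0"
    using free[unfolded free_subalgebras_def, THEN conjunct2, THEN spec[of _ js], THEN spec[of _ ws]]
    by (auto simp: list_all2_conv_all_nth)
  then show ?case by (simp add: coeff_1 E_0)
next
  case (Cons s ss)
  from Cons.prems(2) obtain i ks' where
    ks: "ks = i # ks'" and s: "over (S i) s" "ex s = 0"
    and ss: "list_all2 (\<lambda>i s. over (S i) s \<and> ex s = 0) ks' ss"
    by (auto simp: list_all2_Cons2)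
  have centered: "E (coeff s us) = 0" for us
    using arg_cong[OF s(2), of "\<lambda>t. coeff t us"] by simp
  have "E (prod_list (ws @ [coeff s us]) * coeff (prod_list ss) vs) = 0" for us vs
  proof (rule Cons.IH[of "js @ [i]" _ ks'])
    show "list_all2 (\<lambda>i w. w \<in> S i \<and> E w = 0) (js @ [i]) (ws @ [coeff s us])"
      using Cons.prems(1) s(1) centered
      by (simp add: list_all2_append list_all2_lengthD over_def)
  qed (use Cons.prems ss ks in auto)
  then show ?case
    by (simp add: coeff_mult sum_distrib_left E_sum case_prod_unfold mult.assoc)
qed

lemma free_series:
  assumes "free_subalgebras scaleA emb E J S"
    and "list_all2 (\<lambda>i s. over (S i) s \<and> ex s = 0) ks ss"
    and "ks \<noteq> []" "set ks \<subseteq> J" "distinct_adj ks"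
  shows "ex (prod_list ss) = 0"
  using free_series_aux[OF assms(1), of "[]" "[]" ks ss] assms by (intro ser_eqI) simp

end

primrec alternating :: "nat \<Rightarrow> 'c \<Rightarrow> 'c \<Rightarrow> 'c list" where
  "alternating 0 p q = []"
| "alternating (Suc n) p q = p # alternating n q p"

text \<open>
  The four kinds of terms in the expansion of \<open>(1 + q) (p q)\<^sup>n (1 + p)\<close>.
\<close>

lemma prod_list_alternating:
  fixes p q :: "'c::monoid_mult"
  shows "prod_list (alternating (2 * n) p q) = (p * q) ^ n"
    and "prod_list (alternating (Suc (2 * n)) p q) = (p * q) ^ n * p"
    and "prod_list (alternating (Suc (2 * n)) q p) = q * (p * q) ^ n"
    and "prod_list (alternating (Suc (Suc (2 * n))) q p) = q * ((p * q) ^ n * p)"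
proof -
  show even: "prod_list (alternating (2 * n) p q) = (p * q) ^ n" for p q :: 'c
    by (induction n) (simp_all add: mult.assoc)
  show odd: "prod_list (alternating (Suc (2 * n)) p q) = (p * q) ^ n * p" for p q :: 'c
    by (induction n) (simp_all add: mult.assoc)
  show "prod_list (alternating (Suc (2 * n)) q p) = q * (p * q) ^ n"
    by (simp add: even)
  show "prod_list (alternating (Suc (Suc (2 * n))) q p) = q * ((p * q) ^ n * p)"
    using odd[of p q] by simp
qed

lemma set_alternating: "set (alternating n p q) \<subseteq> {p, q}"
  by (induction n arbitrary: p q) auto

lemma distinct_adj_alternating: "p \<noteq> q \<Longrightarrow> distinct_adj (alternating n p q)"
proof (induction n arbitrary: p q)
  case (Suc n)
  then show ?case by (cases n) (auto simp: distinct_adj_Cons)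
qed simp

lemma list_all2_alternating: "P i a \<Longrightarrow> P j b \<Longrightarrow> list_all2 P (alternating n i j) (alternating n a b)"
  by (induction n arbitrary: i j a b) auto

lemma coeff_mult_power_eq_0:
  fixes w :: "('b, 'v::{ring, monoid_mult}) ser"
  assumes "coeff w [] = 0" "length bs < n"
  shows "coeff (w ^ n * s) bs = 0"
  using assms(2)
proof (induction n arbitrary: bs)
  case (Suc n)
  have "coeff w us * coeff (w ^ n * s) vs = 0" if "(us, vs) \<in> splits bs" for us vs
  proof (cases us)
    case (Cons c us')
    then show ?thesis using that Suc by (auto simp: splits_def)
  qed (simp add: assms(1))
  then show ?case
    by (auto simp: mult.assoc coeff_mult[of w] intro!: sum.neutral)
qed simp

lemma geo_expand:
  assumes "coeff w [] = 0"
  shows "geo w = (\<Sum>k<n. w ^ k) + w ^ n * geo w"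
proof (induction n)
  case (Suc n)
  have "w ^ n * geo w = w ^ n + w ^ Suc n * geo w"
    using arg_cong[OF geo_unfold[OF assms], of "\<lambda>s. w ^ n * s"]
    by (simp add: distrib_left power_Suc2 mult.assoc del: power_Suc)
  then show ?case
    by (subst Suc) (simp add: add.assoc)
qed simp

text \<open>
  Haagerup's identity: with \<open>s = (1 + a)\<^sup>-\<^sup>1\<close>, \<open>p = 1 + a\<close>, \<open>q = 1 + b\<close> and \<open>t = (1 + b)\<^sup>-\<^sup>1\<close> the factor in the middle is
  \<open>1 - a b\<close>.
\<close>

lemma inverse_factorization:
  fixes s t p q :: "'c::{ring, monoid_mult}"
  assumes "s * p = 1" "q * t = 1"
  shows "s * (q + p - p * q) * t = s + t - 1"
proof -
  have "s * (q + p - p * q) * t = s * (q * t) + (s * p) * t - (s * p) * (q * t)"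
    by (simp only: distrib_left distrib_right left_diff_distrib right_diff_distrib mult.assoc)
  then show ?thesis by (simp add: assms)
qed

context valued_ncps
begin

text \<open>
  Expanding the geometric series leaves alternating products of the centered series \<open>a\<close> and \<open>b\<close>, which
  have expectation zero, and the unit.
\<close>

lemma free_centered_inverse:
  fixes a b :: "('b, 'a) ser"
  assumes free: "free_subalgebras scaleA emb E J S" and ij: "i \<in> J" "j \<in> J" "i \<noteq> j"
    and a: "over (S i) a" "ex a = 0" "coeff a [] = 0"
    and b: "over (S j) b" "ex b = 0"
  shows "ex ((1 + b) * geo (a * b) * (1 + a)) = 1"
proof (rule ser_eqI)
  fix bs :: "'b list"
  have 1: "ex (prod_list (alternating (Suc n) a b)) = 0" for n
    by (rule free_series[OF free, where ks = "alternating (Suc n) i j"],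
        rule list_all2_alternating)
       (use a b ij set_alternating[of "Suc n" i j] distinct_adj_alternating[of i j "Suc n"] in auto)
  have 2: "ex (prod_list (alternating (Suc n) b a)) = 0" for n
    by (rule free_series[OF free, where ks = "alternating (Suc n) j i"],
        rule list_all2_alternating)
       (use a b ij set_alternating[of "Suc n" j i] distinct_adj_alternating[of j i "Suc n"] in auto)
  have word_moment: "ex ((1 + b) * (a * b) ^ n * (1 + a)) = (if n = 0 then 1 else 0)" for n
  proof -
    have "ex ((a * b) ^ n) = (if n = 0 then 1 else 0)"
    proof (cases n)
      case (Suc m)
      then have "Suc (2 * n - 1) = 2 * n" by simp
      then show ?thesis
        using 1[of "2 * n - 1"] Suc by (simp only: prod_list_alternating) simp
    qed (simp add: ex_one)
    moreover have "(1 + b) * (a * b) ^ n * (1 + a) =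
        (a * b) ^ n + (a * b) ^ n * a + b * (a * b) ^ n + b * ((a * b) ^ n * a)"
      by (simp add: distrib_left distrib_right mult.assoc)
    moreover have "ex ((a * b) ^ n * a) = 0" "ex (b * (a * b) ^ n) = 0" "ex (b * ((a * b) ^ n * a)) = 0"
      by (fact 1[of "2 * n", unfolded prod_list_alternating(2)]
          2[of "2 * n", unfolded prod_list_alternating(3)]
          2[of "Suc (2 * n)", unfolded prod_list_alternating(4)])+
    ultimately show ?thesis
      by (simp add: ex_add)
  qed
  \<comment> \<open>At a fixed word only finitely many powers contribute, since the constant term
      of \<open>a b\<close> vanishes.\<close>
  define n where "n = Suc (length bs)"
  let ?w = "a * b"
  have w: "coeff ?w [] = 0" by (simp add: a)
  have rest: "coeff ((1 + b) * (?w ^ n * (geo ?w * (1 + a)))) bs = 0"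
    unfolding coeff_mult[of "1 + b"] case_prod_unfold
  proof (intro sum.neutral ballI)
    fix p assume "p \<in> splits bs"
    then have "length (snd p) < n"
      using splits_length[of "fst p" "snd p" bs] by (simp add: n_def)
    then show "coeff (1 + b) (fst p) * coeff (?w ^ n * (geo ?w * (1 + a))) (snd p) = 0"
      by (simp only: coeff_mult_power_eq_0[OF w] mult_zero_right)
  qed
  have "(1 + b) * geo ?w * (1 + a) = (1 + b) * ((\<Sum>k<n. ?w ^ k) + ?w ^ n * geo ?w) * (1 + a)"
    by (simp only: flip: geo_expand[OF w])
  also have "\<dots> = (\<Sum>k<n. (1 + b) * ?w ^ k * (1 + a)) + (1 + b) * (?w ^ n * (geo ?w * (1 + a)))"
    by (simp only: distrib_left[of "1 + b"] distrib_right[of _ _ "1 + a"] sum_distrib_left sum_distrib_right mult.assoc)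
  finally have "coeff (ex ((1 + b) * geo ?w * (1 + a))) bs =
      (\<Sum>k<n. coeff (ex ((1 + b) * ?w ^ k * (1 + a))) bs)"
    by (simp only: coeff_map_ser coeff_add coeff_sum rest add_0_right E_sum)
  also have "\<dots> = (\<Sum>k<n. if k = 0 then coeff 1 bs else 0)"
    by (rule sum.cong) (simp_all only: word_moment, simp)
  also have "\<dots> = coeff 1 bs"
    by (simp add: n_def)
  finally show "coeff (ex ((1 + b) * geo ?w * (1 + a))) bs = coeff 1 bs" .
qed

text \<open>
  The factorization \<open>1 - (u + v) = (1 - u) (1 - a b) (1 - v)\<close>, where \<open>1 + a\<close> and \<open>1 + b\<close> are the inverses of \<open>1 - u\<close> and
  \<open>1 - v\<close>, presents the inverse of \<open>1 - (u + v)\<close> as \<open>(1 + b) (1 - a b)\<^sup>-\<^sup>1 (1 + a)\<close>.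
\<close>

lemma ex_geo_add_free:
  fixes u v :: "('b, 'a) ser"
  assumes free: "free_subalgebras scaleA emb E J S" and ij: "i \<in> J" "j \<in> J" "i \<noteq> j"
    and u: "over (S i) u" "coeff u [] = 0" "ex (geo u) = 1"
    and v: "over (S j) v" "coeff v [] = 0" "ex (geo v) = 1"
  shows "ex (geo (u + v)) = 1"
proof -
  define a b where "a = geo u - 1" and "b = geo v - 1"
  have geo: "geo u = 1 + a" "geo v = 1 + b"
    by (simp_all add: a_def b_def)
  have S: "is_subalgebra scaleA (S i)" "is_subalgebra scaleA (S j)"
    using free ij by (simp_all add: free_subalgebras_def)
  have a: "over (S i) a" "coeff a [] = 0" and b: "over (S j) b"
    using u v by (simp_all add: a_def b_def over_diff over_one over_geo S coeff_1)
  have ab: "ex a = 0" "ex b = 0"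
    using u v by (simp_all add: geo ex_add ex_one)
  have pu: "(1 - u) * (1 + a) = 1" "(1 + a) * (1 - u) = 1"
    and pv: "(1 - v) * (1 + b) = 1" "(1 + b) * (1 - v) = 1"
    and pw: "(1 - a * b) * geo (a * b) = 1"
    using geo_inverse[of u] geo_inverse[of v] geo_inverse[of "a * b"] u v a by (simp_all add: geo)
  let ?T = "(1 + b) * geo (a * b) * (1 + a)"
  have "1 - (u + v) = (1 - u) + (1 - v) - 1"
    by (simp add: algebra_simps)
  also have "\<dots> = (1 - u) * ((1 + b) + (1 + a) - (1 + a) * (1 + b)) * (1 - v)"
    by (rule inverse_factorization[symmetric]) (simp_all only: pu pv)
  also have "(1 + b) + (1 + a) - (1 + a) * (1 + b) = 1 - a * b"
    by (simp add: algebra_simps)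
  finally have factor: "1 - (u + v) = (1 - u) * (1 - a * b) * (1 - v)" .
  have "(1 - (u + v)) * ?T = (1 - u) * ((1 - a * b) * (((1 - v) * (1 + b)) * geo (a * b))) * (1 + a)"
    by (simp only: factor mult.assoc)
  then have inv: "(1 - (u + v)) * ?T = 1"
    by (simp only: pu pv pw mult_1_left mult_1_right)
  have "geo (u + v) * (1 - (u + v)) = 1"
    by (rule geo_inverse) (simp add: u v)
  then have "geo (u + v) = ?T"
    using inv by (rule left_right_inverse_eq)
  then show ?thesis
    using free_centered_inverse[OF free ij a(1) ab(1) a(2) b ab(2)] by simp
qed

text \<open>
  By the characterization through shifted resolvents, it suffices that the one with \<open>x + y\<close> and the sum of the two
  R-transforms has expectation 1; it is the inverse of \<open>1 - (u + v)\<close> for the shifted series of \<open>x\<close> and \<open>y\<close>.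
\<close>

lemma R_transform_add_free:
  assumes free: "free_subalgebras scaleA emb E J S" and ij: "i \<in> J" "j \<in> J" "i \<noteq> j"
    and x: "x \<in> S i" and y: "y \<in> S j"
  shows "R_transform scaleB (distribution_series emb E (x + y)) =
    R_transform scaleB (distribution_series emb E x) \<oplus> R_transform scaleB (distribution_series emb E y)"
proof -
  define R where "R z = Ser (R_transform scaleB (distribution_series emb E z))" for z
  define u where "u z r = up ident * (const z - up r)" for z and r :: "('b, 'b) ser"
  have centered: "ex (geo (u z (R z))) = 1" "multilinear scaleB (R z)" for z
  proof -
    obtain f where "multilinear scaleB (R z)" "R_equation (Ser (distribution_series emb E z)) (R z) f"
      using B.R_transform_equation[OF multilinear_distribution[of z]] by (auto simp: R_def)
    then show "ex (geo (u z (R z))) = 1" "multilinear scaleB (R z)"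
      using ex_geo_eq_one_iff[of "R z" f z] by (auto simp: u_def R_equation_def)
  qed
  have over_u: "over (S k) (u z (R z))" if "z \<in> S k" "k \<in> J" for z k
  proof -
    have S: "is_subalgebra scaleA (S k)" "range emb \<subseteq> S k"
      using free that by (auto simp: free_subalgebras_def)
    then have "0 \<in> S k"
      using emb_0 by (metis rangeI subsetD)
    then have "over (S k) (up t)" "over (S k) (const z :: ('b, 'a) ser)" for t :: "('b, 'b) ser"
      using S that by (auto simp: over_def coeff_const)
    then show ?thesis
      unfolding u_def by (intro over_mult[OF S(1)] over_diff[OF S(1)])
  qed
  let ?r = "R x + R y"
  have "ex (geo (u x (R x) + u y (R y))) = 1"
    by (rule ex_geo_add_free[OF free ij])
       (simp_all add: centered over_u x y ij, simp_all add: u_def emb_0)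
  moreover have "u x (R x) + u y (R y) = u (x + y) ?r"
  proof -
    have "const (x + y) = (const x + const y :: ('b, 'a) ser)"
      by (rule ser_eqI) (simp add: coeff_const)
    then show ?thesis by (simp add: u_def up_add algebra_simps)
  qed
  ultimately have ex: "ex (geo (u (x + y) ?r)) = 1" by simp
  define f where "f = geo (- (ident * ?r)) * ident"
  have "multilinear scaleB f"
    unfolding f_def
    by (intro B.multilinear_mult B.multilinear_geo B.multilinear_uminus B.multilinear_add B.multilinear_ident centered)
  moreover have "(1 + ident * ?r) * f = ident"
    using geo_inverse[of "- (ident * ?r)"] by (simp add: f_def flip: mult.assoc)
  then have "R_equation (Ser (distribution_series emb E (x + y))) ?r f"
    using ex ex_geo_eq_one_iff by (simp add: u_def)
  ultimately have "R (x + y) = ?r"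
    using B.R_transform_unique[OF multilinear_distribution] by (simp add: R_def)
  then show ?thesis
    by (simp add: R_def Ser_inject flip: Ser_mul_add)
qed

end

theorem theorem6p13:
  fixes scaleB :: "'k::field \<Rightarrow> 'b::{ring, monoid_mult} \<Rightarrow> 'b"
    and scaleA :: "'k \<Rightarrow> 'a::{ring, monoid_mult} \<Rightarrow> 'a"
    and emb :: "'b \<Rightarrow> 'a"
    and E :: "'a \<Rightarrow> 'b"
    and x y :: 'a
  assumes "valued_ncps scaleB scaleA emb E"
    and "free_variables scaleA emb E {..<2::nat} (\<lambda>i. [x, y] ! i)"
  shows "R_transform scaleB (distribution_series emb E (x + y)) =
         R_transform scaleB (distribution_series emb E x) \<oplus>
         R_transform scaleB (distribution_series emb E y)"
proof -
  interpret valued_ncps scaleB scaleA emb E by fact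
  let ?S = "\<lambda>i. is_subalgebra scaleA hull ({[x, y] ! i} \<union> range emb)"
  have "x \<in> ?S 0" "y \<in> ?S (Suc 0)"
    using hull_subset[of "{x} \<union> range emb" "is_subalgebra scaleA"]
      hull_subset[of "{y} \<union> range emb" "is_subalgebra scaleA"] by auto
  then show ?thesis
    using assms(2) R_transform_add_free[of "{..<2}" ?S 0 "Suc 0"]
    by (simp add: free_variables_def)
qed

end
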